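(* Let $(\mathcal{M},g)$ be a paracompact, connected, pseudo-Riemannian manifold of dimension $n$ and signature $(p,q)$, let $U\subseteq\mathcal{M}$ be an open set with a local orthonormal coframe $\{e^1,\dots,e^n\}$ of $T^{*}\mathcal{M}$, and let $\mathbf{v}=e^1\wedge e^2\wedge\cdots\wedge e^n$ be the volume element. If $n=\dim\mathcal{M}$ is odd, then $\mathbf{v}$ is central in the Graf--Clifford algebra $(\Gamma(U,\bigwedge(T^{*}\mathcal{M})),\diamond)$, i.e. $\mathbf{v}\diamond f=f\diamond\mathbf{v}$ for all $f\in\Gamma(U,\bigwedge(T^{*}\mathcal{M}))$.
   Context: Let $\{e_1,\dots,e_n\}$ be the frame of $T\mathcal{M}$ over $U$ dual to $\{e^i\}$, so $e^i(e_j)=\delta^i_j$. Let $g^{*}$ be the metric induced by $g$ on $T^{*}\mathcal{M}$ and $g^{ij}=g^{*}(e^i,e^j)$; orthonormal means $g^{ij}=0$ for $i\ne j$, $g^{ii}=1$ for $1\le i\le p$ and $g^{ii}=-1$ for $p+1\le i\le n$. $e_i\rfloor$ denotes contraction (interior product) on forms: the linear map of degree $-1$ vanishing on $0$-forms with $e_i\rfloor e^j=\delta_i^j$ and $e_i\rfloor(\alpha\wedge\beta)=(e_i\rfloor\alpha)\wedge\beta+(-1)^{\deg\alpha}\alpha\wedge(e_i\rfloor\beta)$. The contracted wedge product of order $l\ge 0$ on $\Gamma(U,\bigwedge(T^{*}\mathcal{M}))$ is defined iteratively by $f_1\wedge_0 f_2=f_1\wedge f_2$ and $f_1\wedge_l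 f_2=\sum_{i,j=1}^n g^{ij}(e_i\rfloor f_1)\wedge_{l-1}(e_j\rfloor f_2)$ for $l\ge1$. The Graf product $\diamond$ is the bilinear product on $\Gamma(U,\bigwedge(T^{*}\mathcal{M}))$ defined for an $r$-form $f_1$ and an $s$-form $f_2$ with $r\le s$ by $$f_1\diamond f_2=\sum_{l=0}^r\frac{(-1)^{l(r-l)+[l/2]}}{l!}f_1\wedge_l f_2,\qquad f_2\diamond f_1=(-1)^{rs}\sum_{l=0}^r\frac{(-1)^{l(r-l+1)+[l/2]}}{l!}f_1\wedge_l f_2,$$ where $[x]$ is the integer part of $x$. The algebra $(\Gamma(U,\bigwedge(T^{*}\mathcal{M})),\diamond)$ is called the Graf--Clifford algebra. *)

theory Defs
  imports "HOL-Analysis.Analysis"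
begin

section \<open>Smooth manifolds\<close>

primrec Ck_on :: "nat \<Rightarrow> 'b::euclidean_space set \<Rightarrow> ('b \<Rightarrow> 'c::real_normed_vector) \<Rightarrow> bool" where
  "Ck_on 0 S f \<longleftrightarrow> continuous_on S f"
| "Ck_on (Suc k) S f \<longleftrightarrow> f differentiable_on S \<and> (\<forall>w. Ck_on k S (\<lambda>y. frechet_derivative f (at y) w))"

text \<open>Only used for open \<open>S\<close>.\<close>

definition smooth_on :: "'b::euclidean_space set \<Rightarrow> ('b \<Rightarrow> 'c::real_normed_vector) \<Rightarrow> bool" where
  "smooth_on S f \<longleftrightarrow> (\<forall>k. Ck_on k S f)"

type_synonym ('a, 'n) chart = "'a set \<times> ('a \<Rightarrow> real ^ 'n)"

definition chart_inv :: "('a, 'n) chart \<Rightarrow> real ^ 'n \<Rightarrow> 'a" where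
  "chart_inv c = inv_into (fst c) (snd c)"

definition transition :: "('a, 'n) chart \<Rightarrow> ('a, 'n) chart \<Rightarrow> real ^ 'n \<Rightarrow> real ^ 'n" where
  "transition c c' = snd c' \<circ> chart_inv c"

locale smooth_manifold =
  fixes M :: "'a topology" and A :: "('a, 'n::finite) chart set"
  assumes Hausdorff: "Hausdorff_space M"
    and chart_openin: "\<And>c. c \<in> A \<Longrightarrow> openin M (fst c)"
    and chart_open: "\<And>c. c \<in> A \<Longrightarrow> open (snd c ` fst c)"
    and chart_homeomorphic: "\<And>c. c \<in> A \<Longrightarrow>
          homeomorphic_map (subtopology M (fst c)) (top_of_set (snd c ` fst c)) (snd c)"
    and chart_cover: "(\<Union>c\<in>A. fst c) = topspace M"
    and chart_compatible: "\<And>c c'. c \<in> A \<Longrightarrow> c' \<in> A \<Longrightarrow>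
          smooth_on (snd c ` (fst c \<inter> fst c')) (transition c c')"

definition paracompact_space :: "'a topology \<Rightarrow> bool" where
  "paracompact_space M \<longleftrightarrow>
    (\<forall>\<U>. (\<forall>V\<in>\<U>. openin M V) \<and> \<Union>\<U> = topspace M \<longrightarrow>
      (\<exists>\<V>. (\<forall>V\<in>\<V>. openin M V) \<and> \<Union>\<V> = topspace M \<and>
           (\<forall>V\<in>\<V>. \<exists>W\<in>\<U>. V \<subseteq> W) \<and> locally_finite_in M \<V>))"

section \<open>Tangent vectors\<close>

text \<open>
  A tangent vector at a point is the family of its coordinate vectors, one for each chart around
  the point, transforming under change of charts by the differential of the transition map. The
  value is fixed to 0 on all other charts, so that equality of tangent vectors is equality of
  functions. The vector space operations are pointwise.
\<close>

type_synonym ('a, 'n) tvec = "('a, 'n) chart \<Rightarrow> real ^ 'n"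

definition tangent_space :: "('a, 'n::finite) chart set \<Rightarrow> 'a \<Rightarrow> ('a, 'n) tvec set" where
  "tangent_space A x = {v.
     (\<forall>c. \<not> (c \<in> A \<and> x \<in> fst c) \<longrightarrow> v c = 0) \<and>
     (\<forall>c c'. c \<in> A \<and> x \<in> fst c \<and> c' \<in> A \<and> x \<in> fst c' \<longrightarrow>
        v c' = frechet_derivative (transition c c') (at (snd c x)) (v c))}"

text \<open>The tangent vector at \<open>x\<close> whose coordinate vector in the chart \<open>c\<close> is \<open>w\<close>.\<close>

definition coord_vec :: "('a, 'n::finite) chart set \<Rightarrow> ('a, 'n) chart \<Rightarrow> 'a \<Rightarrow> real ^ 'n \<Rightarrow> ('a, 'n) tvec" where
  "coord_vec A c x w =
     (\<lambda>c'. if c' \<in> A \<and> x \<in> fst c'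
           then frechet_derivative (transition c c') (at (snd c x)) w else 0)"

definition lin_comb :: "real \<Rightarrow> ('i \<Rightarrow> 'b::real_vector) \<Rightarrow> real \<Rightarrow> ('i \<Rightarrow> 'b) \<Rightarrow> 'i \<Rightarrow> 'b" where
  "lin_comb a u b w = (\<lambda>i. a *\<^sub>R u i + b *\<^sub>R w i)"

text \<open>\<open>b 1, \<dots>, b n\<close> is a basis of a space \<open>W\<close> of functions with pointwise operations.\<close>

definition basis_of :: "nat \<Rightarrow> (nat \<Rightarrow> 'i \<Rightarrow> 'b::real_vector) \<Rightarrow> ('i \<Rightarrow> 'b) set \<Rightarrow> bool" where
  "basis_of n b W \<longleftrightarrow>
     (\<forall>i\<in>{1..n}. b i \<in> W) \<and>
     (\<forall>w\<in>W. \<exists>!a :: nat \<Rightarrow> real. (\<forall>i. i \<notin> {1..n} \<longrightarrow> a i = 0) \<and>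
        w = (\<lambda>z. \<Sum>i=1..n. a i *\<^sub>R b i z))"

section \<open>Pseudo-Riemannian metrics\<close>

text \<open>Nondegeneracy is part of the clause on the signature.\<close>

locale pseudo_riemannian_manifold = smooth_manifold M A
  for M :: "'a topology" and A :: "('a, 'n::finite) chart set" +
  fixes g :: "'a \<Rightarrow> ('a, 'n) tvec \<Rightarrow> ('a, 'n) tvec \<Rightarrow> real" and p q :: nat
  assumes metric_sym: "\<And>x u v. x \<in> topspace M \<Longrightarrow> u \<in> tangent_space A x \<Longrightarrow> v \<in> tangent_space A x \<Longrightarrow>
          g x u v = g x v u"
    and metric_linear: "\<And>x u v w a b. x \<in> topspace M \<Longrightarrow>
          u \<in> tangent_space A x \<Longrightarrow> v \<in> tangent_space A x \<Longrightarrow> w \<in> tangent_space A x \<Longrightarrow>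
          g x (lin_comb a u b v) w = a * g x u w + b * g x v w"
    and metric_smooth: "\<And>c w w'. c \<in> A \<Longrightarrow>
          smooth_on (snd c ` fst c)
            (\<lambda>y. g (chart_inv c y) (coord_vec A c (chart_inv c y) w) (coord_vec A c (chart_inv c y) w'))"
    and dimension: "p + q = CARD('n)"
    and metric_signature: "\<And>x. x \<in> topspace M \<Longrightarrow>
          \<exists>b. basis_of CARD('n) b (tangent_space A x) \<and>
             (\<forall>i\<in>{1..CARD('n)}. \<forall>j\<in>{1..CARD('n)}.
                g x (b i) (b j) = (if i \<noteq> j then 0 else if i \<le> p then 1 else -1))"

section \<open>The exterior algebra of the cotangent space\<close>

text \<open>
  An element of the exterior algebra (of mixed degree) is a function on finite lists of tangent
  vectors; its component of degree \<open>k\<close> is its restriction to lists of length \<open>k\<close>, an alternating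
  \<open>k\<close>-linear form. Lists that contain something else than tangent vectors are sent to 0.
\<close>

type_synonym 'v form = "'v list \<Rightarrow> real"

definition exterior_algebra :: "('a, 'n::finite) chart set \<Rightarrow> 'a \<Rightarrow> ('a, 'n) tvec form set" where
  "exterior_algebra A x = {\<omega>.
     (\<forall>vs. \<not> set vs \<subseteq> tangent_space A x \<longrightarrow> \<omega> vs = 0) \<and>
     (\<forall>vs i u w a b. set vs \<subseteq> tangent_space A x \<and> i < length vs \<and>
        u \<in> tangent_space A x \<and> w \<in> tangent_space A x \<longrightarrow>
        \<omega> (vs[i := lin_comb a u b w]) = a * \<omega> (vs[i := u]) + b * \<omega> (vs[i := w])) \<and>
     (\<forall>vs i j. set vs \<subseteq> tangent_space A x \<and> i < j \<and> j < length vs \<and> vs ! i = vs ! j \<longrightarrow> \<omega> vs = 0)}"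

definition homogeneous :: "nat \<Rightarrow> 'v form \<Rightarrow> bool" where
  "homogeneous k \<omega> \<longleftrightarrow> (\<forall>vs. length vs \<noteq> k \<longrightarrow> \<omega> vs = 0)"

definition cotangent_space :: "('a, 'n::finite) chart set \<Rightarrow> 'a \<Rightarrow> ('a, 'n) tvec form set" where
  "cotangent_space A x = {\<omega> \<in> exterior_algebra A x. homogeneous 1 \<omega>}"

text \<open>
  Exterior product as a sum over shuffles: \<open>S\<close> is the set of positions of the vectors that are
  fed to the first factor, and the exponent is the number of inversions of the shuffle. In degree
  one, \<open>(\<alpha> \<and> \<beta>)(u, v) = \<alpha>(u) \<beta>(v) - \<alpha>(v) \<beta>(u)\<close>.
\<close>

definition shuffle_inv :: "nat \<Rightarrow> nat set \<Rightarrow> nat" where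
  "shuffle_inv k S = card {(i, j). i < j \<and> j < k \<and> i \<notin> S \<and> j \<in> S}"

definition wedge_at :: "'v form \<Rightarrow> 'v form \<Rightarrow> 'v form" where
  "wedge_at \<alpha> \<beta> = (\<lambda>vs. \<Sum>S\<in>Pow {..<length vs}.
     (-1) ^ shuffle_inv (length vs) S * \<alpha> (nths vs S) * \<beta> (nths vs (- S)))"

section \<open>Sections of the exterior bundle\<close>

text \<open>Sections over \<open>U\<close> are extended by 0 outside \<open>U\<close>.\<close>

type_synonym ('a, 'n) form_field = "'a \<Rightarrow> ('a, 'n) tvec form"

definition form_sections :: "('a, 'n::finite) chart set \<Rightarrow> 'a set \<Rightarrow> ('a, 'n) form_field set" where
  "form_sections A U = {f.
     (\<forall>x\<in>U. f x \<in> exterior_algebra A x) \<and>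
     (\<forall>x. x \<notin> U \<longrightarrow> f x = (\<lambda>vs. 0)) \<and>
     (\<forall>c\<in>A. \<forall>ws. smooth_on (snd c ` (U \<inter> fst c))
        (\<lambda>y. f (chart_inv c y) (map (coord_vec A c (chart_inv c y)) ws)))}"

definition wedge :: "('a, 'n) form_field \<Rightarrow> ('a, 'n) form_field \<Rightarrow> ('a, 'n) form_field" where
  "wedge f h = (\<lambda>x. wedge_at (f x) (h x))"

definition one_form_field :: "'a set \<Rightarrow> ('a, 'n) form_field" where
  "one_form_field U = (\<lambda>x vs. if x \<in> U \<and> vs = [] then 1 else 0)"

definition degree_part :: "nat \<Rightarrow> ('a, 'n) form_field \<Rightarrow> ('a, 'n) form_field" where
  "degree_part k f = (\<lambda>x vs. if length vs = k then f x vs else 0)"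

definition interior_product :: "('a \<Rightarrow> ('a, 'n) tvec) \<Rightarrow> ('a, 'n) form_field \<Rightarrow> ('a, 'n) form_field" where
  "interior_product X f = (\<lambda>x vs. f x (X x # vs))"

section \<open>Orthonormal coframes\<close>

definition coframe :: "('a, 'n::finite) chart set \<Rightarrow> 'a set \<Rightarrow> (nat \<Rightarrow> ('a, 'n) form_field) \<Rightarrow> bool" where
  "coframe A U e \<longleftrightarrow>
     (\<forall>i\<in>{1..CARD('n)}. e i \<in> form_sections A U) \<and>
     (\<forall>x\<in>U. basis_of CARD('n) (\<lambda>i. e i x) (cotangent_space A x))"

definition dual_frame :: "('a, 'n::finite) chart set \<Rightarrow> (nat \<Rightarrow> ('a, 'n) form_field) \<Rightarrow> nat \<Rightarrow> 'a \<Rightarrow> ('a, 'n) tvec" where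
  "dual_frame A e j x =
     (THE v. v \<in> tangent_space A x \<and> (\<forall>i\<in>{1..CARD('n)}. e i x [v] = (if i = j then 1 else 0)))"

definition sharp :: "('a, 'n::finite) chart set \<Rightarrow> ('a \<Rightarrow> ('a, 'n) tvec \<Rightarrow> ('a, 'n) tvec \<Rightarrow> real) \<Rightarrow>
    'a \<Rightarrow> ('a, 'n) tvec form \<Rightarrow> ('a, 'n) tvec" where
  "sharp A g x \<alpha> = (THE v. v \<in> tangent_space A x \<and> (\<forall>w\<in>tangent_space A x. g x v w = \<alpha> [w]))"

definition dual_metric :: "('a, 'n::finite) chart set \<Rightarrow> ('a \<Rightarrow> ('a, 'n) tvec \<Rightarrow> ('a, 'n) tvec \<Rightarrow> real) \<Rightarrow>
    'a \<Rightarrow> ('a, 'n) tvec form \<Rightarrow> ('a, 'n) tvec form \<Rightarrow> real" where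
  "dual_metric A g x \<alpha> \<beta> = g x (sharp A g x \<alpha>) (sharp A g x \<beta>)"

definition orthonormal_coframe :: "('a, 'n::finite) chart set \<Rightarrow> ('a \<Rightarrow> ('a, 'n) tvec \<Rightarrow> ('a, 'n) tvec \<Rightarrow> real) \<Rightarrow>
    nat \<Rightarrow> 'a set \<Rightarrow> (nat \<Rightarrow> ('a, 'n) form_field) \<Rightarrow> bool" where
  "orthonormal_coframe A g p U e \<longleftrightarrow> coframe A U e \<and>
     (\<forall>x\<in>U. \<forall>i\<in>{1..CARD('n)}. \<forall>j\<in>{1..CARD('n)}.
        dual_metric A g x (e i x) (e j x) = (if i \<noteq> j then 0 else if i \<le> p then 1 else -1))"

definition volume_element :: "'a set \<Rightarrow> (nat \<Rightarrow> ('a, 'n::finite) form_field) \<Rightarrow> ('a, 'n) form_field" where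
  "volume_element U e = foldr (\<lambda>i f. wedge (e i) f) [1..<Suc CARD('n)] (one_form_field U)"

section \<open>The Graf product\<close>

fun contracted_wedge :: "('a, 'n::finite) chart set \<Rightarrow> ('a \<Rightarrow> ('a, 'n) tvec \<Rightarrow> ('a, 'n) tvec \<Rightarrow> real) \<Rightarrow>
    (nat \<Rightarrow> ('a, 'n) form_field) \<Rightarrow> nat \<Rightarrow> ('a, 'n) form_field \<Rightarrow> ('a, 'n) form_field \<Rightarrow> ('a, 'n) form_field" where
  "contracted_wedge A g e 0 f h = wedge f h"
| "contracted_wedge A g e (Suc l) f h =
     (\<lambda>x vs. \<Sum>i=1..CARD('n). \<Sum>j=1..CARD('n). dual_metric A g x (e i x) (e j x) *
        contracted_wedge A g e l (interior_product (dual_frame A e i) f) (interior_product (dual_frame A e j) h) x vs)"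

text \<open>
  The product of an \<open>r\<close>-form \<open>f\<close> and an \<open>s\<close>-form \<open>h\<close>. In the second case the form of
  smaller degree is the right factor \<open>h\<close>. For \<open>r = s\<close> both formulas give the same value.
\<close>

definition graf_homogeneous :: "('a, 'n::finite) chart set \<Rightarrow> ('a \<Rightarrow> ('a, 'n) tvec \<Rightarrow> ('a, 'n) tvec \<Rightarrow> real) \<Rightarrow>
    (nat \<Rightarrow> ('a, 'n) form_field) \<Rightarrow> nat \<Rightarrow> nat \<Rightarrow> ('a, 'n) form_field \<Rightarrow> ('a, 'n) form_field \<Rightarrow> ('a, 'n) form_field" where
  "graf_homogeneous A g e r s f h =
     (if r \<le> s
      then (\<lambda>x vs. \<Sum>l=0..r.
              (-1) ^ (l * (r - l) + l div 2) / fact l * contracted_wedge A g e l f h x vs)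
      else (\<lambda>x vs. (-1) ^ (r * s) * (\<Sum>l=0..s.
              (-1) ^ (l * (s - l + 1) + l div 2) / fact l * contracted_wedge A g e l h f x vs)))"

definition graf :: "('a, 'n::finite) chart set \<Rightarrow> ('a \<Rightarrow> ('a, 'n) tvec \<Rightarrow> ('a, 'n) tvec \<Rightarrow> real) \<Rightarrow>
    (nat \<Rightarrow> ('a, 'n) form_field) \<Rightarrow> ('a, 'n) form_field \<Rightarrow> ('a, 'n) form_field \<Rightarrow> ('a, 'n) form_field" where
  "graf A g e f h =
     (\<lambda>x vs. \<Sum>r=0..CARD('n). \<Sum>s=0..CARD('n).
        graf_homogeneous A g e r s (degree_part r f) (degree_part s h) x vs)"

section \<open>The interior product is the contraction antiderivation\<close>

lemma interior_product_linear:
  "interior_product X (\<lambda>x vs. a * f x vs + b * h x vs) = (\<lambda>x vs. a * interior_product X f x vs + b * interior_product X h x vs)"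
  by (simp add: interior_product_def)

lemma interior_product_degree:
  assumes "\<And>x. homogeneous (Suc k) (f x)"
  shows "homogeneous k (interior_product X f x)"
  using assms by (simp add: homogeneous_def interior_product_def)

lemma interior_product_zero_form:
  assumes "\<And>x. homogeneous 0 (f x)"
  shows "interior_product X f = (\<lambda>x vs. 0)"
  using assms by (simp add: homogeneous_def interior_product_def)

lemma interior_product_one_form:
  assumes "\<And>x. homogeneous 1 (f x)"
  shows "interior_product X f = (\<lambda>x vs. if vs = [] then f x [X x] else 0)"
  using assms by (auto simp: homogeneous_def interior_product_def fun_eq_iff)

lemma shuffle_inv_insert:
  assumes "T \<subseteq> {..<k}"
  shows "shuffle_inv (Suc k) (insert 0 (Suc ` T)) = shuffle_inv k T"
proof -
  have "{(i, j). i < j \<and> j < Suc k \<and> i \<notin> insert 0 (Suc ` T) \<and> j \<in> insert 0 (Suc ` T)}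
      = map_prod Suc Suc ` {(i, j). i < j \<and> j < k \<and> i \<notin> T \<and> j \<in> T}" (is "?L = _ ` ?R")
  proof (intro equalityI subsetI)
    fix z assume z: "z \<in> ?L"
    obtain i j where "z = (i, j)" by force
    with z show "z \<in> map_prod Suc Suc ` ?R"
      by (cases i; cases j) (auto simp: image_iff)
  qed (auto simp: image_iff)
  then show ?thesis
    unfolding shuffle_inv_def
    by (simp add: card_image map_prod_inj_on inj_on_subset[OF map_prod_inj_on[of Suc UNIV Suc UNIV]])
qed

lemma shuffle_inv_shift:
  assumes "T \<subseteq> {..<k}"
  shows "shuffle_inv (Suc k) (Suc ` T) = card T + shuffle_inv k T"
proof -
  let ?R = "{(i, j). i < j \<and> j < k \<and> i \<notin> T \<and> j \<in> T}"
  have eq: "{(i, j). i < j \<and> j < Suc k \<and> i \<notin> Suc ` T \<and> j \<in> Suc ` T}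
      = Pair 0 ` Suc ` T \<union> map_prod Suc Suc ` ?R" (is "?L = ?P \<union> ?Q")
  proof (intro equalityI subsetI)
    fix z assume z: "z \<in> ?L"
    obtain i j where "z = (i, j)" by force
    with z show "z \<in> ?P \<union> ?Q"
      by (cases i; cases j) (auto simp: image_iff)
  qed (use assms in \<open>auto simp: image_iff\<close>)
  have fR: "finite ?R"
    by (rule finite_subset[of _ "{..<k} \<times> {..<k}"]) auto
  have fT: "finite T" using assms finite_subset by blast
  have "card ?P = card T"
    by (simp add: card_image inj_on_def)
  moreover have "card ?Q = card ?R"
    by (intro card_image inj_on_subset[OF map_prod_inj_on[of Suc UNIV Suc UNIV]]) auto
  moreover have "?P \<inter> ?Q = {}" by auto
  ultimately show ?thesis
    unfolding shuffle_inv_def eq using fR fT by (simp add: card_Un_disjoint)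
qed

lemma Pow_lessThan_Suc:
  "Pow {..<Suc k} = (\<lambda>T. insert 0 (Suc ` T)) ` Pow {..<k} \<union> (`) Suc ` Pow {..<k}"
  (is "_ = ?P \<union> ?Q")
proof (intro equalityI subsetI)
  fix S assume S: "S \<in> Pow {..<Suc k}"
  define T where "T = {i. Suc i \<in> S}"
  have T: "T \<in> Pow {..<k}" using S by (auto simp: T_def)
  show "S \<in> ?P \<union> ?Q"
  proof (cases "0 \<in> S")
    case True
    then have "S = insert 0 (Suc ` T)"
      by (auto simp: T_def image_iff) (metis not0_implies_Suc)
    with T show ?thesis by blast
  next
    case False
    then have "S = Suc ` T"
      by (auto simp: T_def image_iff) (metis not0_implies_Suc)
    with T show ?thesis by blast
  qed
qed auto

lemma interior_product_antiderivation:
  fixes f h :: "('a, 'n) form_field"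
  assumes "\<And>x. homogeneous k (f x)"
  shows "interior_product X (wedge f h) =
    (\<lambda>x vs. wedge (interior_product X f) h x vs + (-1) ^ k * wedge f (interior_product X h) x vs)"
proof (intro ext)
  fix x and vs :: "('a, 'n) tvec list"
  let ?m = "length vs"
  let ?F = "\<lambda>S. (-1) ^ shuffle_inv (Suc ?m) S * f x (nths (X x # vs) S) * h x (nths (X x # vs) (- S))"
  have fin: "finite (Pow {..<?m})" by simp
  have inj1: "inj_on (\<lambda>T. insert 0 (Suc ` T)) (Pow {..<?m})"
    by (auto simp: inj_on_def image_iff set_eq_iff)
  have inj2: "inj_on ((`) Suc) (Pow {..<?m})"
    by (auto simp: inj_on_def)
  have sets: "{j. Suc j \<in> Suc ` T} = T" "{j. Suc j \<notin> Suc ` T} = - T" "0 \<notin> Suc ` T" for T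
    by auto
  have "interior_product X (wedge f h) x vs = (\<Sum>S\<in>Pow {..<Suc ?m}. ?F S)"
    by (simp add: interior_product_def wedge_def wedge_at_def)
  also have "\<dots> = (\<Sum>T\<in>Pow {..<?m}. ?F (insert 0 (Suc ` T))) + (\<Sum>T\<in>Pow {..<?m}. ?F (Suc ` T))"
    unfolding Pow_lessThan_Suc using fin
    by (subst sum.union_disjoint) (auto simp: sum.reindex[OF inj1] sum.reindex[OF inj2] o_def)
  also have "(\<Sum>T\<in>Pow {..<?m}. ?F (insert 0 (Suc ` T))) = wedge (interior_product X f) h x vs"
    unfolding wedge_def wedge_at_def interior_product_def
    by (intro sum.cong refl) (simp add: nths_Cons shuffle_inv_insert sets)
  also have "(\<Sum>T\<in>Pow {..<?m}. ?F (Suc ` T)) = (-1) ^ k * wedge f (interior_product X h) x vs"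
    unfolding wedge_def wedge_at_def interior_product_def sum_distrib_left
  proof (intro sum.cong refl)
    fix T assume T: "T \<in> Pow {..<?m}"
    have len: "length (nths vs T) = card T"
      using T by (auto simp: length_nths intro!: arg_cong[where f = card])
    have *: "f x (nths vs T) = 0" if "card T \<noteq> k"
      using assms that len by (auto simp: homogeneous_def)
    show "?F (Suc ` T) = (-1) ^ k * ((-1) ^ shuffle_inv ?m T * f x (nths vs T) * h x (X x # nths vs (- T)))"
    proof (cases "card T = k")
      case True
      then show ?thesis using T
        by (simp add: nths_Cons shuffle_inv_shift sets power_add)
    next
      case False
      then show ?thesis using * by (simp add: nths_Cons sets)
    qed
  qed
  finally show "interior_product X (wedge f h) x vs =
    wedge (interior_product X f) h x vs + (-1) ^ k * wedge f (interior_product X h) x vs" .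
qed

end

theory Submission
  imports Defs
begin

text \<open>
  The Graf product of forms only involves their values at one point \<open>x\<close>, so the statement is one
  about the exterior algebra of a single tangent space. There the orthonormal coframe has a dual
  frame \<open>d 1, \<dots>, d n\<close> (lemma \<open>dual_frame_expansion\<close>), and since \<open>g\<^sup>i\<^sup>j = 0\<close> for \<open>i \<noteq> j\<close>,
  the contracted wedge product of order \<open>l\<close> is a combination of the products
  \<open>(d i\<^sub>l \<rfloor> \<dots> \<rfloor> d i\<^sub>1 \<rfloor> f) \<and> (d i\<^sub>l \<rfloor> \<dots> \<rfloor> d i\<^sub>1 \<rfloor> h)\<close>.

  The central observation is that both factors of such a product are forms in the \<open>n - l\<close> remaining
  directions only. The product therefore vanishes when its degree is larger than \<open>n - l\<close>; for
  \<open>f\<close> of degree \<open>k\<close> and \<open>h\<close> of degree \<open>m\<close> that happens as soon as \<open>k + m > n + l\<close> (lemma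
  \<open>contracted_wedge_eq_0\<close>). If \<open>h\<close> is a top form, so \<open>m = n\<close>, all orders \<open>l < k\<close> disappear and
  both Graf products of \<open>f\<close> and \<open>h\<close> reduce to their last term, of order \<open>k\<close>.

  For \<open>k < n\<close> these two terms are the same contracted wedge product with coefficients whose quotient
  is \<open>(-1)\<^bsup>nk + k\<^esup>\<close>, which is 1 for odd \<open>n\<close>. For \<open>k = n\<close> the coefficients agree, and the two factors
  are contracted to scalars, which commute (lemma \<open>contracted_wedge_full_commute\<close>). So every
  top form is central, in particular the volume element.
\<close>

section \<open>Tangent spaces as linear spaces of functions\<close>

text \<open>
  Tangent vectors are functions on charts with pointwise operations; linear subspaces of a function
  space and linear forms on them are described through \<open>lin_comb\<close>.
\<close>

definition lin_closed :: "('i \<Rightarrow> 'b::real_vector) set \<Rightarrow> bool" where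
  "lin_closed T \<longleftrightarrow> (\<lambda>z. 0) \<in> T \<and> (\<forall>a b. \<forall>u\<in>T. \<forall>w\<in>T. lin_comb a u b w \<in> T)"

definition linear_form_on :: "('i \<Rightarrow> 'b::real_vector) set \<Rightarrow> (('i \<Rightarrow> 'b) \<Rightarrow> real) \<Rightarrow> bool" where
  "linear_form_on T \<phi> \<longleftrightarrow> (\<forall>a b. \<forall>u\<in>T. \<forall>w\<in>T. \<phi> (lin_comb a u b w) = a * \<phi> u + b * \<phi> w)"

lemma lin_closed_sum:
  assumes T: "lin_closed T" and J: "finite J" and d: "\<And>i. i \<in> J \<Longrightarrow> d i \<in> T"
  shows "(\<lambda>z. \<Sum>i\<in>J. c i *\<^sub>R d i z) \<in> T"
  using J d
proof (induction J rule: finite_induct)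
  case empty
  then show ?case using T by (simp add: lin_closed_def)
next
  case (insert j J)
  have "(\<lambda>z. \<Sum>i\<in>insert j J. c i *\<^sub>R d i z) = lin_comb (c j) (d j) 1 (\<lambda>z. \<Sum>i\<in>J. c i *\<^sub>R d i z)"
    using insert by (simp add: lin_comb_def)
  then show ?case
    using T insert unfolding lin_closed_def by auto
qed

lemma linear_form_on_sum:
  assumes T: "lin_closed T" and \<phi>: "linear_form_on T \<phi>"
    and J: "finite J" and d: "\<And>i. i \<in> J \<Longrightarrow> d i \<in> T"
  shows "\<phi> (\<lambda>z. \<Sum>i\<in>J. c i *\<^sub>R d i z) = (\<Sum>i\<in>J. c i * \<phi> (d i))"
  using J d
proof (induction J rule: finite_induct)
  case empty
  have "(\<lambda>z. 0) \<in> T" using T by (simp add: lin_closed_def)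
  then have "\<phi> (lin_comb 0 (\<lambda>z. 0) 0 (\<lambda>z. 0)) = 0"
    using \<phi> by (simp add: linear_form_on_def)
  then show ?case by (simp add: lin_comb_def)
next
  case (insert j J)
  have eq: "(\<lambda>z. \<Sum>i\<in>insert j J. c i *\<^sub>R d i z) = lin_comb (c j) (d j) 1 (\<lambda>z. \<Sum>i\<in>J. c i *\<^sub>R d i z)"
    using insert by (simp add: lin_comb_def)
  have "(\<lambda>z. \<Sum>i\<in>J. c i *\<^sub>R d i z) \<in> T"
    by (rule lin_closed_sum[OF T]) (use insert in auto)
  then show ?case
    using \<phi> insert unfolding eq linear_form_on_def by auto
qed

lemma (in smooth_manifold) transition_differentiable:
  assumes "c \<in> A" "c' \<in> A" "x \<in> fst c" "x \<in> fst c'"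
  shows "transition c c' differentiable at (snd c x)"
proof -
  let ?S = "snd c ` (fst c \<inter> fst c')"
  have "openin (subtopology M (fst c)) (fst c \<inter> fst c')"
    using chart_openin[OF assms(2)] by (metis inf_commute openin_subtopology_Int)
  then have "openin (top_of_set (snd c ` fst c)) ?S"
    using homeomorphic_imp_open_map[OF chart_homeomorphic[OF assms(1)]]
    by (simp add: open_map_def)
  then have "open ?S"
    using chart_open[OF assms(1)] openin_open_eq by blast
  moreover have "transition c c' differentiable_on ?S"
    using chart_compatible[OF assms(1,2)] unfolding smooth_on_def
    by (metis Ck_on.simps(2))
  ultimately show ?thesis
    using assms by (auto simp: differentiable_on_eq_differentiable_at)
qed

text \<open>
  The transformation rule of tangent vectors is linear because the transition maps are differentiable;
  without differentiability \<open>frechet_derivative\<close> would be an unspecified map.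
\<close>

lemma (in smooth_manifold) tangent_space_lin_closed: "lin_closed (tangent_space A x)"
proof -
  let ?D = "\<lambda>c c'. frechet_derivative (transition c c') (at (snd c x))"
  have lin: "linear (?D c c')" if "c \<in> A" "c' \<in> A" "x \<in> fst c" "x \<in> fst c'" for c c'
    using transition_differentiable[OF that] by (rule linear_frechet_derivative)
  have "(\<lambda>c. 0) \<in> tangent_space A x"
    unfolding tangent_space_def mem_Collect_eq
    by (intro conjI allI impI) (auto simp: linear_0[OF lin])
  moreover have "lin_comb a u b w \<in> tangent_space A x"
    if u: "u \<in> tangent_space A x" and w: "w \<in> tangent_space A x" for a b u w
    unfolding tangent_space_def mem_Collect_eq
  proof (intro conjI allI impI)
    fix c assume "\<not> (c \<in> A \<and> x \<in> fst c)"
    then have "u c = 0" "w c = 0"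
      using u w unfolding tangent_space_def by blast+
    then show "lin_comb a u b w c = 0"
      by (simp add: lin_comb_def)
  next
    fix c c' assume *: "c \<in> A \<and> x \<in> fst c \<and> c' \<in> A \<and> x \<in> fst c'"
    then have lin': "linear (?D c c')" using lin by blast
    have "u c' = ?D c c' (u c)" "w c' = ?D c c' (w c)"
      using u w * unfolding tangent_space_def by blast+
    then show "lin_comb a u b w c' = ?D c c' (lin_comb a u b w c)"
      by (simp add: lin_comb_def linear_add[OF lin'] linear_cmul[OF lin'])
  qed
  ultimately show ?thesis
    unfolding lin_closed_def by blast
qed

section \<open>Contraction and the exterior algebra at a point\<close>

definition contract :: "'v \<Rightarrow> 'v form \<Rightarrow> 'v form" where
  "contract v \<omega> = (\<lambda>vs. \<omega> (v # vs))"

lemma interior_product_at: "interior_product X f x = contract (X x) (f x)"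
  by (simp add: interior_product_def contract_def)

lemma contract_zero [simp]: "contract v (\<lambda>vs. 0) = (\<lambda>vs. 0)"
  by (simp add: contract_def)

lemma homogeneous_contract: "homogeneous k \<omega> \<Longrightarrow> homogeneous (k - 1) (contract v \<omega>)"
  by (auto simp: homogeneous_def contract_def)

lemma contract_homogeneous_0: "homogeneous 0 \<omega> \<Longrightarrow> contract v \<omega> = (\<lambda>vs. 0)"
  by (auto simp: homogeneous_def contract_def)

lemma wedge_at_zero_left [simp]: "wedge_at (\<lambda>vs. 0) \<beta> = (\<lambda>vs. 0)"
  and wedge_at_zero_right [simp]: "wedge_at \<alpha> (\<lambda>vs. 0) = (\<lambda>vs. 0)"
  by (simp_all add: wedge_at_def)

lemma wedge_at_linear_left:
  "wedge_at (\<lambda>vs. a * \<alpha> vs + b * \<alpha>' vs) \<beta> vs = a * wedge_at \<alpha> \<beta> vs + b * wedge_at \<alpha>' \<beta> vs"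
  by (simp add: wedge_at_def sum_distrib_left sum.distrib[symmetric] algebra_simps)

lemma wedge_at_linear_right:
  "wedge_at \<alpha> (\<lambda>vs. a * \<beta> vs + b * \<beta>' vs) vs = a * wedge_at \<alpha> \<beta> vs + b * wedge_at \<alpha> \<beta>' vs"
  by (simp add: wedge_at_def sum_distrib_left sum.distrib[symmetric] algebra_simps)

lemma homogeneous_wedge_at:
  assumes "homogeneous k \<alpha>" "homogeneous m \<beta>"
  shows "homogeneous (k + m) (wedge_at \<alpha> \<beta>)"
  unfolding homogeneous_def
proof (intro allI impI)
  fix vs :: "'a list" assume len: "length vs \<noteq> k + m"
  show "wedge_at \<alpha> \<beta> vs = 0"
    unfolding wedge_at_def
  proof (intro sum.neutral ballI)
    fix S assume "S \<in> Pow {..<length vs}"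
    have "{i. i < length vs \<and> i \<in> S} \<union> {i. i < length vs \<and> i \<in> - S} = {..<length vs}"
      by auto
    then have "length (nths vs S) + length (nths vs (- S)) = length vs"
      unfolding length_nths by (subst card_Un_disjoint[symmetric]) auto
    then have "length (nths vs S) \<noteq> k \<or> length (nths vs (- S)) \<noteq> m"
      using len by auto
    then show "(- 1) ^ shuffle_inv (length vs) S * \<alpha> (nths vs S) * \<beta> (nths vs (- S)) = 0"
      using assms by (auto simp: homogeneous_def)
  qed
qed

text \<open>
  The antiderivation rule at a single point, obtained from the one for form fields by taking constant
  fields. It makes induction on the number of arguments possible without looking at shuffles again.
\<close>

lemma wedge_at_Cons:
  fixes \<alpha> \<beta> :: "('a, 'n) tvec form"
  assumes "homogeneous k \<alpha>"
  shows "wedge_at \<alpha> \<beta> (v # vs) =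
    wedge_at (contract v \<alpha>) \<beta> vs + (-1) ^ k * wedge_at \<alpha> (contract v \<beta>) vs"
proof -
  have "interior_product (\<lambda>_::'a. v) (wedge (\<lambda>_. \<alpha>) (\<lambda>_. \<beta>)) x vs =
      wedge (interior_product (\<lambda>_. v) (\<lambda>_. \<alpha>)) (\<lambda>_. \<beta>) x vs
      + (-1) ^ k * wedge (\<lambda>_. \<alpha>) (interior_product (\<lambda>_. v) (\<lambda>_. \<beta>)) x vs" for x
    using assms by (subst interior_product_antiderivation[where k = k]) auto
  then show ?thesis
    by (simp add: wedge_def interior_product_at contract_def)
qed

lemma exterior_algebra_outside:
  "\<omega> \<in> exterior_algebra A x \<Longrightarrow> \<not> set vs \<subseteq> tangent_space A x \<Longrightarrow> \<omega> vs = 0"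
  by (simp add: exterior_algebra_def)

lemma exterior_algebra_multilinear:
  "\<omega> \<in> exterior_algebra A x \<Longrightarrow> set vs \<subseteq> tangent_space A x \<Longrightarrow> i < length vs \<Longrightarrow>
    u \<in> tangent_space A x \<Longrightarrow> w \<in> tangent_space A x \<Longrightarrow>
    \<omega> (vs[i := lin_comb a u b w]) = a * \<omega> (vs[i := u]) + b * \<omega> (vs[i := w])"
  unfolding exterior_algebra_def by blast

lemma exterior_algebra_repeated:
  "\<omega> \<in> exterior_algebra A x \<Longrightarrow> i < j \<Longrightarrow> j < length vs \<Longrightarrow> vs ! i = vs ! j \<Longrightarrow> \<omega> vs = 0"
  unfolding exterior_algebra_def by blast

lemma exterior_algebra_linear:
  assumes "\<omega> \<in> exterior_algebra A x" "u \<in> tangent_space A x" "w \<in> tangent_space A x"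
  shows "\<omega> (lin_comb a u b w # vs) = a * \<omega> (u # vs) + b * \<omega> (w # vs)"
proof (cases "set vs \<subseteq> tangent_space A x")
  case True
  have "\<omega> ((u # vs)[0 := lin_comb a u b w]) = a * \<omega> ((u # vs)[0 := u]) + b * \<omega> ((u # vs)[0 := w])"
    by (rule exterior_algebra_multilinear[OF assms(1)]) (use assms True in auto)
  then show ?thesis by simp
next
  case False
  then show ?thesis
    using exterior_algebra_outside[OF assms(1)] by simp
qed

lemma exterior_algebra_alternating:
  assumes "\<omega> \<in> exterior_algebra A x"
  shows "\<omega> (u # u # vs) = 0"
  using exterior_algebra_repeated[OF assms, of 0 1 "u # u # vs"] by simp

lemma exterior_algebra_contract:
  assumes "\<omega> \<in> exterior_algebra A x" "u \<in> tangent_space A x"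
  shows "contract u \<omega> \<in> exterior_algebra A x"
  unfolding exterior_algebra_def mem_Collect_eq
proof (intro conjI allI impI)
  fix vs assume "\<not> set vs \<subseteq> tangent_space A x"
  then show "contract u \<omega> vs = 0"
    using exterior_algebra_outside[OF assms(1)] by (simp add: contract_def)
next
  fix vs i v w a b
  assume "set vs \<subseteq> tangent_space A x \<and> i < length vs \<and> v \<in> tangent_space A x \<and> w \<in> tangent_space A x"
  then have "\<omega> ((u # vs)[Suc i := lin_comb a v b w]) =
      a * \<omega> ((u # vs)[Suc i := v]) + b * \<omega> ((u # vs)[Suc i := w])"
    using assms by (intro exterior_algebra_multilinear) auto
  then show "contract u \<omega> (vs[i := lin_comb a v b w]) =
      a * contract u \<omega> (vs[i := v]) + b * contract u \<omega> (vs[i := w])"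
    by (simp add: contract_def)
next
  fix vs i j
  assume "set vs \<subseteq> tangent_space A x \<and> i < j \<and> j < length vs \<and> vs ! i = vs ! j"
  then show "contract u \<omega> vs = 0"
    using exterior_algebra_repeated[OF assms(1), of "Suc i" "Suc j" "u # vs"]
    by (simp add: contract_def)
qed

text \<open>
  Polarization of \<open>\<omega> (s, s, \<dots>) = 0\<close> at \<open>s = u + w\<close>. The hypotheses only concern the first two slots, so that
  the lemma also applies to a function that is yet to be recognized as an alternating form.
\<close>

lemma alternating_imp_antisymmetric:
  fixes \<omega> :: "('i \<Rightarrow> 'b::real_vector) form"
  assumes T: "lin_closed T"
    and lin: "\<And>a b u w vs. u \<in> T \<Longrightarrow> w \<in> T \<Longrightarrow>
        \<omega> (lin_comb a u b w # vs) = a * \<omega> (u # vs) + b * \<omega> (w # vs)"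
    and lin': "\<And>a b u v w vs. v \<in> T \<Longrightarrow> u \<in> T \<Longrightarrow> w \<in> T \<Longrightarrow>
        \<omega> (v # lin_comb a u b w # vs) = a * \<omega> (v # u # vs) + b * \<omega> (v # w # vs)"
    and alt: "\<And>u vs. u \<in> T \<Longrightarrow> \<omega> (u # u # vs) = 0"
    and uw: "u \<in> T" "w \<in> T"
  shows "\<omega> (u # w # vs) = - \<omega> (w # u # vs)"
proof -
  let ?s = "lin_comb 1 u 1 w"
  have "?s \<in> T" using T uw by (simp add: lin_closed_def)
  then have "0 = \<omega> (?s # ?s # vs)" using alt by simp
  also have "\<dots> = \<omega> (u # w # vs) + \<omega> (w # u # vs)"
    using uw \<open>?s \<in> T\<close> lin[OF uw] lin'[OF _ uw] alt by simp
  finally show ?thesis by simp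
qed

lemma exterior_algebra_antisymmetric:
  assumes T: "lin_closed (tangent_space A x)" and \<omega>: "\<omega> \<in> exterior_algebra A x"
    and u: "u \<in> tangent_space A x" and w: "w \<in> tangent_space A x"
  shows "\<omega> (u # w # vs) = - \<omega> (w # u # vs)"
proof (rule alternating_imp_antisymmetric[OF T])
  show "\<omega> (v # lin_comb a u b w # vs) = a * \<omega> (v # u # vs) + b * \<omega> (v # w # vs)"
    if "v \<in> tangent_space A x" "u \<in> tangent_space A x" "w \<in> tangent_space A x" for a b u v w vs
    using exterior_algebra_linear[OF exterior_algebra_contract[OF \<omega> that(1)] that(2,3)]
    by (simp add: contract_def)
qed (use exterior_algebra_linear[OF \<omega>] exterior_algebra_alternating[OF \<omega>] u w in blast)+

text \<open>
  A recursive criterion for alternating forms: only the first slot, and equality of the first two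
  arguments, have to be examined, the other slots being left to the contractions. A repetition in
  slots \<open>0\<close> and \<open>j > 1\<close> is reduced to one in slots \<open>1\<close> and \<open>j\<close> by exchanging the first two arguments.
\<close>

lemma exterior_algebraI:
  assumes T: "lin_closed (tangent_space A x)"
    and outside: "\<And>vs. \<not> set vs \<subseteq> tangent_space A x \<Longrightarrow> \<omega> vs = 0"
    and lin: "\<And>a b u w vs. u \<in> tangent_space A x \<Longrightarrow> w \<in> tangent_space A x \<Longrightarrow>
        \<omega> (lin_comb a u b w # vs) = a * \<omega> (u # vs) + b * \<omega> (w # vs)"
    and alt: "\<And>u vs. u \<in> tangent_space A x \<Longrightarrow> \<omega> (u # u # vs) = 0"
    and contr: "\<And>u. u \<in> tangent_space A x \<Longrightarrow> contract u \<omega> \<in> exterior_algebra A x"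
  shows "\<omega> \<in> exterior_algebra A x"
  unfolding exterior_algebra_def mem_Collect_eq
proof (intro conjI allI impI)
  fix vs i u w a b
  assume H: "set vs \<subseteq> tangent_space A x \<and> i < length vs \<and> u \<in> tangent_space A x \<and> w \<in> tangent_space A x"
  then obtain v ws where vs: "vs = v # ws" by (cases vs) auto
  show "\<omega> (vs[i := lin_comb a u b w]) = a * \<omega> (vs[i := u]) + b * \<omega> (vs[i := w])"
  proof (cases i)
    case 0
    then show ?thesis using H lin by (simp add: vs)
  next
    case (Suc j)
    have "contract v \<omega> \<in> exterior_algebra A x" using contr H by (simp add: vs)
    then have "contract v \<omega> (ws[j := lin_comb a u b w]) =
        a * contract v \<omega> (ws[j := u]) + b * contract v \<omega> (ws[j := w])"
      by (rule exterior_algebra_multilinear) (use H in \<open>auto simp: vs Suc\<close>)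
    then show ?thesis by (simp add: contract_def vs Suc)
  qed
next
  fix vs i j
  assume H: "set vs \<subseteq> tangent_space A x \<and> i < j \<and> j < length vs \<and> vs ! i = vs ! j"
  then obtain v ws where vs: "vs = v # ws" by (cases vs) auto
  have v: "v \<in> tangent_space A x" using H by (simp add: vs)
  have repeated: "contract y \<omega> ys = 0"
    if "y \<in> tangent_space A x" "k < l" "l < length ys" "ys ! k = ys ! l"
    for y ys k l
    by (rule exterior_algebra_repeated[OF contr[OF that(1)] that(2-4)])
  obtain j' where j: "j = Suc j'" using H by (cases j) auto
  show "\<omega> vs = 0"
  proof (cases i)
    case (Suc i')
    then show ?thesis
      using H repeated[of v i' j' ws] by (simp add: vs j contract_def)
  next
    case 0
    show ?thesis
    proof (cases j')
      case 0
      then obtain ws' where "ws = v # ws'"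
        using H \<open>i = 0\<close> j by (cases ws) (auto simp: vs)
      then show ?thesis using alt v by (simp add: vs)
    next
      case (Suc j'')
      then obtain w ws' where ws: "ws = w # ws'"
        using H j by (cases ws) (auto simp: vs)
      have w: "w \<in> tangent_space A x" using H by (simp add: vs ws)
      have "\<omega> (v # w # ws') = - \<omega> (w # v # ws')"
      proof (rule alternating_imp_antisymmetric[OF T lin _ alt v w])
        show "\<omega> (v # lin_comb a u b w # vs) = a * \<omega> (v # u # vs) + b * \<omega> (v # w # vs)"
          if "v \<in> tangent_space A x" "u \<in> tangent_space A x" "w \<in> tangent_space A x" for a b u v w vs
          using exterior_algebra_linear[OF contr[OF that(1)] that(2,3)]
          by (simp add: contract_def)
      qed
      also have "\<omega> (w # v # ws') = 0"
        using repeated[OF w, of 0 "Suc j''" "v # ws'"] H Suc j \<open>i = 0\<close> v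
        by (auto simp: vs ws contract_def)
      finally show ?thesis by (simp add: vs ws)
    qed
  qed
qed (use outside in blast)

lemma exterior_algebra_combination:
  assumes "\<omega> \<in> exterior_algebra A x" "\<eta> \<in> exterior_algebra A x"
  shows "(\<lambda>vs. \<omega> vs + b * \<eta> vs) \<in> exterior_algebra A x"
  unfolding exterior_algebra_def mem_Collect_eq
proof (intro conjI allI impI)
  fix vs assume "\<not> set vs \<subseteq> tangent_space A x"
  then show "\<omega> vs + b * \<eta> vs = 0"
    using assms[THEN exterior_algebra_outside] by simp
next
  fix vs i u w r t
  assume "set vs \<subseteq> tangent_space A x \<and> i < length vs \<and> u \<in> tangent_space A x \<and> w \<in> tangent_space A x"
  then have "\<omega> (vs[i := lin_comb r u t w]) = r * \<omega> (vs[i := u]) + t * \<omega> (vs[i := w])"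
    "\<eta> (vs[i := lin_comb r u t w]) = r * \<eta> (vs[i := u]) + t * \<eta> (vs[i := w])"
    using assms by (simp_all add: exterior_algebra_multilinear)
  then show "\<omega> (vs[i := lin_comb r u t w]) + b * \<eta> (vs[i := lin_comb r u t w])
      = r * (\<omega> (vs[i := u]) + b * \<eta> (vs[i := u])) + t * (\<omega> (vs[i := w]) + b * \<eta> (vs[i := w]))"
    by (simp add: algebra_simps)
next
  fix vs i j
  assume "set vs \<subseteq> tangent_space A x \<and> i < j \<and> j < length vs \<and> vs ! i = vs ! j"
  then have "\<omega> vs = 0" "\<eta> vs = 0"
    using assms[THEN exterior_algebra_repeated] by blast+
  then show "\<omega> vs + b * \<eta> vs = 0" by simp
qed

lemma exterior_algebra_zero: "(\<lambda>vs. 0) \<in> exterior_algebra A x"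
  by (simp add: exterior_algebra_def)

text \<open>
  Induction on the total degree: a contraction of the product is a combination of two products of
  smaller total degree. The square of a contraction vanishes because its two mixed terms
  have opposite signs, and the others contain a double contraction of one factor.
\<close>

lemma wedge_at_exterior_algebra:
  fixes \<alpha> \<beta> :: "('a, 'n::finite) tvec form"
  assumes T: "lin_closed (tangent_space A x)"
    and \<alpha>: "\<alpha> \<in> exterior_algebra A x" "homogeneous k \<alpha>"
    and \<beta>: "\<beta> \<in> exterior_algebra A x" "homogeneous m \<beta>"
  shows "wedge_at \<alpha> \<beta> \<in> exterior_algebra A x"
  using \<alpha> \<beta>
proof (induction "k + m" arbitrary: k m \<alpha> \<beta> rule: less_induct)
  case less
  note \<alpha> = less.prems(1,2) and \<beta> = less.prems(3,4)
  show ?case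
  proof (rule exterior_algebraI[OF T])
    fix vs assume "\<not> set vs \<subseteq> tangent_space A x"
    then obtain v where v: "v \<in> set vs" "v \<notin> tangent_space A x" by blast
    show "wedge_at \<alpha> \<beta> vs = 0"
      unfolding wedge_at_def
    proof (intro sum.neutral ballI)
      fix S
      obtain i where "i < length vs" "vs ! i = v" using v(1) by (auto simp: in_set_conv_nth)
      then have "v \<in> set (nths vs S) \<or> v \<in> set (nths vs (- S))"
        by (auto simp: set_nths)
      then have "\<not> set (nths vs S) \<subseteq> tangent_space A x \<or> \<not> set (nths vs (- S)) \<subseteq> tangent_space A x"
        using v(2) by blast
      then show "(- 1) ^ shuffle_inv (length vs) S * \<alpha> (nths vs S) * \<beta> (nths vs (- S)) = 0"
        using exterior_algebra_outside[OF \<alpha>(1)] exterior_algebra_outside[OF \<beta>(1)] by auto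
    qed
  next
    fix a b u w vs assume uw: "u \<in> tangent_space A x" "w \<in> tangent_space A x"
    have "contract (lin_comb a u b w) \<alpha> = (\<lambda>vs. a * contract u \<alpha> vs + b * contract w \<alpha> vs)"
      "contract (lin_comb a u b w) \<beta> = (\<lambda>vs. a * contract u \<beta> vs + b * contract w \<beta> vs)"
      using exterior_algebra_linear[OF \<alpha>(1) uw] exterior_algebra_linear[OF \<beta>(1) uw]
      by (auto simp: contract_def)
    then show "wedge_at \<alpha> \<beta> (lin_comb a u b w # vs)
        = a * wedge_at \<alpha> \<beta> (u # vs) + b * wedge_at \<alpha> \<beta> (w # vs)"
      unfolding wedge_at_Cons[OF \<alpha>(2)]
      by (simp add: wedge_at_linear_left wedge_at_linear_right algebra_simps)
  next
    fix u vs assume u: "u \<in> tangent_space A x"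
    have twice: "contract u (contract u \<alpha>) = (\<lambda>vs. 0)" "contract u (contract u \<beta>) = (\<lambda>vs. 0)"
      using exterior_algebra_alternating[OF \<alpha>(1)] exterior_algebra_alternating[OF \<beta>(1)]
      by (auto simp: contract_def)
    show "wedge_at \<alpha> \<beta> (u # u # vs) = 0"
    proof (cases k)
      case 0
      have "contract u \<alpha> = (\<lambda>vs. 0)"
        using \<alpha>(2) 0 by (simp add: contract_homogeneous_0)
      then show ?thesis
        by (simp add: wedge_at_Cons[OF \<alpha>(2)] twice)
    next
      case (Suc k')
      have "homogeneous k' (contract u \<alpha>)"
        using homogeneous_contract[OF \<alpha>(2)] Suc by simp
      then show ?thesis
        by (simp add: wedge_at_Cons[OF \<alpha>(2)] wedge_at_Cons[of k' "contract u \<alpha>"] twice Suc)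
    qed
  next
    fix u assume u: "u \<in> tangent_space A x"
    have "wedge_at (contract u \<alpha>) \<beta> \<in> exterior_algebra A x"
    proof (cases k)
      case 0
      then show ?thesis
        using contract_homogeneous_0[of \<alpha> u] \<alpha>(2) exterior_algebra_zero by simp
    next
      case (Suc k')
      show ?thesis
        by (rule less.hyps[of "k - 1" m])
          (use exterior_algebra_contract[OF \<alpha>(1) u] homogeneous_contract[OF \<alpha>(2)] \<beta> Suc in simp_all)
    qed
    moreover have "wedge_at \<alpha> (contract u \<beta>) \<in> exterior_algebra A x"
    proof (cases m)
      case 0
      then show ?thesis
        using contract_homogeneous_0[of \<beta> u] \<beta>(2) exterior_algebra_zero by simp
    next
      case (Suc m')
      show ?thesis
        by (rule less.hyps[of k "m - 1"])
          (use exterior_algebra_contract[OF \<beta>(1) u] homogeneous_contract[OF \<beta>(2)] \<alpha> Suc in simp_all)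
    qed
    ultimately show "contract u (wedge_at \<alpha> \<beta>) \<in> exterior_algebra A x"
      unfolding contract_def[of u "wedge_at \<alpha> \<beta>"] wedge_at_Cons[OF \<alpha>(2)]
      by (rule exterior_algebra_combination)
  qed
qed

section \<open>The frame dual to a coframe\<close>

lemma cotangent_space_linear:
  assumes "\<theta> \<in> cotangent_space A x"
  shows "linear_form_on (tangent_space A x) (\<lambda>v. \<theta> [v])"
  using assms exterior_algebra_linear[of \<theta> A x] 
  by (auto simp: cotangent_space_def linear_form_on_def)

lemma cotangent_spaceI:
  assumes T: "lin_closed (tangent_space A x)"
    and \<phi>: "linear_form_on (tangent_space A x) \<phi>"
  shows "(\<lambda>vs. if length vs = 1 \<and> set vs \<subseteq> tangent_space A x then \<phi> (hd vs) else 0)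
    \<in> cotangent_space A x" (is "?\<omega> \<in> _")
proof -
  have "?\<omega> \<in> exterior_algebra A x"
    unfolding exterior_algebra_def mem_Collect_eq
  proof (intro conjI allI impI)
    fix vs i u w a b
    assume H: "set vs \<subseteq> tangent_space A x \<and> i < length vs \<and> u \<in> tangent_space A x \<and> w \<in> tangent_space A x"
    show "?\<omega> (vs[i := lin_comb a u b w]) = a * ?\<omega> (vs[i := u]) + b * ?\<omega> (vs[i := w])"
    proof (cases "length vs = 1")
      case True
      then obtain v where "vs = [v]" by (auto simp: length_Suc_conv)
      with H have "vs[i := z] = [z]" for z by simp
      moreover have "lin_comb a u b w \<in> tangent_space A x"
        using T H by (simp add: lin_closed_def)
      ultimately show ?thesis
        using H \<phi> by (simp add: linear_form_on_def)
    qed simp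
  qed auto
  then show ?thesis
    by (simp add: cotangent_space_def homogeneous_def)
qed

lemma ex1_unique: "\<exists>!a. P a \<Longrightarrow> P a \<Longrightarrow> P b \<Longrightarrow> a = b"
  by blast

text \<open>
  By uniqueness of the expansion, the coefficients with respect to a basis depend linearly on the
  vector.
\<close>

lemma basis_coefficients:
  assumes T: "lin_closed W" and b: "basis_of n b W"
  obtains c :: "nat \<Rightarrow> ('i \<Rightarrow> 'b::real_vector) \<Rightarrow> real"
  where "\<And>w. w \<in> W \<Longrightarrow> w = (\<lambda>z. \<Sum>i=1..n. c i w *\<^sub>R b i z)"
    and "\<And>i. linear_form_on W (c i)"
proof -
  let ?P = "\<lambda>w a. (\<forall>i. i \<notin> {1..n} \<longrightarrow> a i = (0::real)) \<and> w = (\<lambda>z. \<Sum>i=1..n. a i *\<^sub>R b i z)"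
  have ex: "\<exists>!a. ?P w a" if "w \<in> W" for w
    using b that unfolding basis_of_def by blast
  define c where "c i w = (THE a. ?P w a) i" for i w
  have c: "?P w (\<lambda>i. c i w)" if "w \<in> W" for w
    using theI'[OF ex[OF that]] unfolding c_def .
  have lin: "c i (lin_comb r u t w) = r * c i u + t * c i w" if "u \<in> W" "w \<in> W" for i r u t w
  proof -
    have mem: "lin_comb r u t w \<in> W" using T that by (simp add: lin_closed_def)
    have out: "c i u = 0 \<and> c i w = 0" if "i \<notin> {1..n}" for i
      using c[OF \<open>u \<in> W\<close>] c[OF \<open>w \<in> W\<close>] that by blast
    have expand: "u z = (\<Sum>i=1..n. c i u *\<^sub>R b i z)" "w z = (\<Sum>i=1..n. c i w *\<^sub>R b i z)" for z
      by (rule fun_cong[OF conjunct2[OF c]], fact)+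
    have "lin_comb r u t w = (\<lambda>z. \<Sum>i=1..n. (r * c i u + t * c i w) *\<^sub>R b i z)"
      unfolding lin_comb_def
    proof
      fix z
      have "r *\<^sub>R u z + t *\<^sub>R w z
          = r *\<^sub>R (\<Sum>i=1..n. c i u *\<^sub>R b i z) + t *\<^sub>R (\<Sum>i=1..n. c i w *\<^sub>R b i z)"
        using expand[of z] by simp
      then show "r *\<^sub>R u z + t *\<^sub>R w z = (\<Sum>i=1..n. (r * c i u + t * c i w) *\<^sub>R b i z)"
        by (simp add: scaleR_sum_right sum.distrib scaleR_add_left)
    qed
    then have "?P (lin_comb r u t w) (\<lambda>i. r * c i u + t * c i w)"
      using out by simp
    then have "(THE a. ?P (lin_comb r u t w) a) = (\<lambda>i. r * c i u + t * c i w)"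
      by (rule the1_equality[OF ex[OF mem]])
    from fun_cong[OF this, of i] show ?thesis
      unfolding c_def[of i "lin_comb r u t w"] .
  qed
  show ?thesis
  proof (rule that[of c])
    show "w = (\<lambda>z. \<Sum>i=1..n. c i w *\<^sub>R b i z)" if "w \<in> W" for w
      by (rule conjunct2[OF c[OF that]])
    show "linear_form_on W (c i)" for i
      using lin by (simp add: linear_form_on_def)
  qed
qed

text \<open>
  A basis of the cotangent space does not by itself give vectors; they come from any basis \<open>b\<close> of the
  tangent space, such as the one in the definition of the signature. Let \<open>\<beta> k\<close> be the \<open>k\<close>-th coordinate
  form of \<open>b\<close> and write \<open>\<beta> k = \<Sum>\<^sub>j a k j e j\<close>. Since also \<open>e j = \<Sum>\<^sub>k e j (b k) \<beta> k\<close>, uniqueness of the expansion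
  of \<open>e j\<close> in the basis \<open>e\<close> shows that the matrices \<open>e j (b k)\<close> and \<open>a k j\<close> are inverse to each
  other. Hence the vectors \<open>D j = \<Sum>\<^sub>k a k j b k\<close> are dual to \<open>e\<close>.
\<close>

lemma dual_frame_expansion:
  fixes A :: "('a, 'n::finite) chart set"
  assumes T: "lin_closed (tangent_space A x)"
    and b: "basis_of CARD('n) b (tangent_space A x)"
    and e: "basis_of CARD('n) (\<lambda>i. e i x) (cotangent_space A x)"
  shows "\<And>j. j \<in> {1..CARD('n)} \<Longrightarrow> dual_frame A e j x \<in> tangent_space A x" (is "\<And>j. ?in j \<Longrightarrow> ?M j")
    and "\<And>v. v \<in> tangent_space A x \<Longrightarrow>
      v = (\<lambda>z. \<Sum>j=1..CARD('n). e j x [v] *\<^sub>R dual_frame A e j x z)" (is "\<And>v. ?V v \<Longrightarrow> ?E v")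
proof -
  let ?n = "CARD('n)" and ?T = "tangent_space A x"
  obtain c where expand: "\<And>w. w \<in> ?T \<Longrightarrow> w = (\<lambda>z. \<Sum>i=1..?n. c i w *\<^sub>R b i z)"
    and c: "\<And>i. linear_form_on ?T (c i)"
    using basis_coefficients[OF T b] by blast
  have bT: "b k \<in> ?T" if "k \<in> {1..?n}" for k
    using b that by (simp add: basis_of_def)
  have eC: "e j x \<in> cotangent_space A x" if "j \<in> {1..?n}" for j
    using e that by (simp add: basis_of_def)
  define \<beta> where "\<beta> k = (\<lambda>vs. if length vs = 1 \<and> set vs \<subseteq> ?T then c k (hd vs) else 0)" for k
  have \<beta>: "\<beta> k \<in> cotangent_space A x" for k
    unfolding \<beta>_def by (rule cotangent_spaceI[OF T c])
  have "\<exists>a. \<beta> k = (\<lambda>z. \<Sum>j=1..?n. a j *\<^sub>R e j x z)" for k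
    using e \<beta>[of k] unfolding basis_of_def by blast
  then obtain a where a: "\<And>k. \<beta> k = (\<lambda>z. \<Sum>j=1..?n. a k j *\<^sub>R e j x z)"
    by metis
  have ca: "c k v = (\<Sum>j=1..?n. a k j * e j x [v])" if "v \<in> ?T" for k v
    using that fun_cong[OF a[of k], of "[v]"] by (simp add: \<beta>_def)
  have eval: "e j x [v] = (\<Sum>k=1..?n. c k v * e j x [b k])" if "v \<in> ?T" "j \<in> {1..?n}" for j v
    by (subst expand[OF that(1)],
        rule linear_form_on_sum[OF T cotangent_space_linear[OF eC[OF that(2)]]])
       (use bT in auto)
  have inverse: "(\<Sum>k=1..?n. e j x [b k] * a k m) = (if j = m then 1 else 0)"
    if j: "j \<in> {1..?n}" and m: "m \<in> {1..?n}" for j m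
  proof -
    \<comment> \<open>Two coefficient functions of \<open>e j\<close>, both 0 outside \<open>{1..n}\<close> as \<open>basis_of\<close> requires.\<close>
    let ?s = "\<lambda>m. if m \<in> {1..?n} then (\<Sum>k=1..?n. e j x [b k] * a k m) else 0"
    let ?t = "\<lambda>m. if j = m then 1 else (0::real)"
    have "e j x = (\<lambda>z. \<Sum>m=1..?n. ?s m *\<^sub>R e m x z)"
    proof -
      have *: "(\<lambda>z. \<Sum>m=1..?n. ?s m *\<^sub>R e m x z) = (\<lambda>z. \<Sum>k=1..?n. e j x [b k] * \<beta> k z)"
      proof
        fix z
        have "(\<Sum>m=1..?n. ?s m *\<^sub>R e m x z) = (\<Sum>m=1..?n. \<Sum>k=1..?n. e j x [b k] * a k m * e m x z)"
          by (intro sum.cong) (auto simp: sum_distrib_right)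
        also have "\<dots> = (\<Sum>k=1..?n. \<Sum>m=1..?n. e j x [b k] * a k m * e m x z)"
          by (rule sum.swap)
        also have "\<dots> = (\<Sum>k=1..?n. e j x [b k] * \<beta> k z)"
          by (subst a) (simp add: sum_distrib_left mult.assoc)
        finally show "(\<Sum>m=1..?n. ?s m *\<^sub>R e m x z) = (\<Sum>k=1..?n. e j x [b k] * \<beta> k z)" .
      qed
      show ?thesis
        unfolding *
      proof
        fix vs
        show "e j x vs = (\<Sum>k=1..?n. e j x [b k] * \<beta> k vs)"
        proof (cases "length vs = 1 \<and> set vs \<subseteq> ?T")
          case True
          then obtain v where "vs = [v]" by (auto simp: length_Suc_conv)
          then show ?thesis
            using True eval[OF _ j, of v] by (simp add: \<beta>_def mult.commute)
        next
          case False
          then have "e j x vs = 0"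
            using eC[OF j] exterior_algebra_outside[of "e j x" A x vs]
            unfolding cotangent_space_def homogeneous_def by force
          moreover have "\<beta> k vs = 0" for k
            using False by (simp only: \<beta>_def if_False)
          ultimately show ?thesis by simp
        qed
      qed
    qed
    moreover have "e j x = (\<lambda>z. \<Sum>m=1..?n. ?t m *\<^sub>R e m x z)"
      using j by (simp add: if_distrib[of "\<lambda>r. r * _"] cong: if_cong)
    moreover have "\<exists>!r. (\<forall>i. i \<notin> {1..?n} \<longrightarrow> r i = 0) \<and> e j x = (\<lambda>z. \<Sum>m=1..?n. r m *\<^sub>R e m x z)"
      using e eC[OF j] unfolding basis_of_def by blast
    moreover have "\<forall>i. i \<notin> {1..?n} \<longrightarrow> ?s i = 0" "\<forall>i. i \<notin> {1..?n} \<longrightarrow> ?t i = 0"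
      using j by auto
    ultimately have "?s = ?t"
      by - (erule ex1_unique; intro conjI; assumption)
    from fun_cong[OF this, of m] show ?thesis using m by simp
  qed
  define D where "D j = (\<lambda>z. \<Sum>k=1..?n. a k j *\<^sub>R b k z)" for j
  have DT: "D j \<in> ?T" for j
    unfolding D_def by (rule lin_closed_sum[OF T]) (use bT in auto)
  have eD: "e i x [D j] = (if i = j then 1 else 0)" if "i \<in> {1..?n}" "j \<in> {1..?n}" for i j
  proof -
    have "e i x [D j] = (\<Sum>k=1..?n. a k j * e i x [b k])"
      unfolding D_def
      by (rule linear_form_on_sum[OF T cotangent_space_linear[OF eC[OF that(1)]]]) (use bT in auto)
    then show ?thesis using inverse[OF that] by (simp add: mult.commute)
  qed
  have dual: "dual_frame A e j x = D j" if j: "j \<in> {1..?n}" for j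
    unfolding dual_frame_def
  proof (rule the_equality)
    show "D j \<in> ?T \<and> (\<forall>i\<in>{1..?n}. e i x [D j] = (if i = j then 1 else 0))"
      using DT eD j by blast
  next
    fix v assume v: "v \<in> ?T \<and> (\<forall>i\<in>{1..?n}. e i x [v] = (if i = j then 1 else 0))"
    have "c k v = a k j" for k
    proof -
      have "c k v = (\<Sum>i=1..?n. a k i * (if i = j then 1 else 0))"
        unfolding ca[OF conjunct1[OF v]] using v by (intro sum.cong) auto
      then show ?thesis using j by (simp add: if_distrib cong: if_cong)
    qed
    note coefficients = this
    have "v = (\<lambda>z. \<Sum>k=1..?n. c k v *\<^sub>R b k z)"
      by (rule expand) (use v in blast)
    also have "\<dots> = D j"
      by (simp add: D_def coefficients)
    finally show "v = D j" .
  qed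
  show "?M j" if "?in j" for j
    using dual[OF that] DT by simp
  show "?E v" if "?V v" for v
  proof
    fix z
    have "v z = (\<Sum>k=1..?n. c k v *\<^sub>R b k z)"
      using fun_cong[OF expand[OF that], of z] .
    also have "\<dots> = (\<Sum>k=1..?n. \<Sum>j=1..?n. (a k j * e j x [v]) *\<^sub>R b k z)"
      by (simp add: ca[OF that] scaleR_sum_left)
    also have "\<dots> = (\<Sum>j=1..?n. \<Sum>k=1..?n. (a k j * e j x [v]) *\<^sub>R b k z)"
      by (rule sum.swap)
    also have "\<dots> = (\<Sum>j=1..?n. e j x [v] *\<^sub>R D j z)"
      by (simp add: D_def scaleR_sum_right mult.commute)
    also have "\<dots> = (\<Sum>j=1..?n. e j x [v] *\<^sub>R dual_frame A e j x z)"
      by (intro sum.cong) (simp_all add: dual)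
    finally show "v z = (\<Sum>j=1..?n. e j x [v] *\<^sub>R dual_frame A e j x z)" .
  qed
qed

section \<open>Contracted wedge products at a point with an orthonormal frame\<close>

locale orthonormal_point =
  fixes A :: "('a, 'n::finite) chart set"
    and g :: "'a \<Rightarrow> ('a, 'n) tvec \<Rightarrow> ('a, 'n) tvec \<Rightarrow> real"
    and e :: "nat \<Rightarrow> ('a, 'n) form_field" and x :: 'a
  assumes lin_closed: "lin_closed (tangent_space A x)"
    and frame: "\<And>i. i \<in> {1..CARD('n)} \<Longrightarrow> dual_frame A e i x \<in> tangent_space A x"
    and expansion: "\<And>v. v \<in> tangent_space A x \<Longrightarrow>
      v = (\<lambda>z. \<Sum>i=1..CARD('n). e i x [v] *\<^sub>R dual_frame A e i x z)"
    and orthogonal: "\<And>i j. i \<in> {1..CARD('n)} \<Longrightarrow> j \<in> {1..CARD('n)} \<Longrightarrow> i \<noteq> j \<Longrightarrow>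
      dual_metric A g x (e i x) (e j x) = 0"
begin

abbreviation d :: "nat \<Rightarrow> ('a, 'n) tvec" where
  "d i \<equiv> dual_frame A e i x"

lemma contract_contract_eq_0:
  assumes \<omega>: "\<omega> \<in> exterior_algebra A x" and i: "i \<in> {1..CARD('n)}" and I: "I \<subseteq> {1..CARD('n)}"
    and free: "\<And>j. j \<in> I \<Longrightarrow> contract (d j) \<omega> = (\<lambda>vs. 0)"
    and j: "j \<in> insert i I"
  shows "contract (d j) (contract (d i) \<omega>) = (\<lambda>vs. 0)"
proof (cases "j = i")
  case True
  then show ?thesis
    using exterior_algebra_alternating[OF \<omega>] by (simp add: contract_def)
next
  case False
  with j have "j \<in> I" by simp
  then have "\<omega> (d j # ws) = 0" for ws
    using free[OF \<open>j \<in> I\<close>] by (simp add: contract_def fun_eq_iff)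
  moreover have "d j \<in> tangent_space A x" using frame \<open>j \<in> I\<close> I by blast
  ultimately show ?thesis
    using exterior_algebra_antisymmetric[OF lin_closed \<omega> frame[OF i]]
    by (simp add: contract_def)
qed

text \<open>
  A form all of whose contractions with the frame vectors indexed by \<open>I\<close> vanish lives on the span of
  the remaining \<open>n - |I|\<close> frame vectors, so its degree cannot exceed \<open>n - |I|\<close>. Feeding a further
  frame vector \<open>d i\<close> into the form lowers the degree by one and adds \<open>i\<close> to \<open>I\<close>, which keeps the
  hypothesis; this is the induction.
\<close>

lemma form_eq_0:
  assumes "\<omega> \<in> exterior_algebra A x" "homogeneous k \<omega>"
    and "I \<subseteq> {1..CARD('n)}" "\<And>i. i \<in> I \<Longrightarrow> contract (d i) \<omega> = (\<lambda>vs. 0)"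
    and "CARD('n) < k + card I"
  shows "\<omega> vs = 0"
  using assms
proof (induction vs arbitrary: \<omega> k I)
  case Nil
  have "card I \<le> CARD('n)" using card_mono[OF _ Nil(3)] by simp
  then have "k \<noteq> 0" using Nil by linarith
  then show ?case using Nil by (auto simp: homogeneous_def)
next
  case (Cons v vs)
  show ?case
  proof (cases "v \<in> tangent_space A x")
    case False
    then show ?thesis using exterior_algebra_outside[OF Cons.prems(1), of "v # vs"] by simp
  next
    case True
    have lin: "linear_form_on (tangent_space A x) (\<lambda>v. \<omega> (v # vs))"
      using exterior_algebra_linear[OF Cons.prems(1)] by (simp add: linear_form_on_def)
    have zero: "\<omega> (d i # vs) = 0" if i: "i \<in> {1..CARD('n)}" for i
    proof (cases "i \<in> I \<or> k = 0")
      case True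
      then have "contract (d i) \<omega> = (\<lambda>vs. 0)"
        using Cons.prems(2,4) contract_homogeneous_0 by metis
      then show ?thesis by (simp add: contract_def fun_eq_iff)
    next
      case False
      have fin: "finite I" using Cons.prems(3) finite_subset by blast
      have "contract (d i) \<omega> vs = 0"
      proof (rule Cons.IH[of _ "k - 1" "insert i I"])
        show "contract (d i) \<omega> \<in> exterior_algebra A x"
          by (rule exterior_algebra_contract[OF Cons.prems(1) frame[OF i]])
        show "homogeneous (k - 1) (contract (d i) \<omega>)"
          by (rule homogeneous_contract[OF Cons.prems(2)])
        show "insert i I \<subseteq> {1..CARD('n)}" using Cons.prems(3) i by blast
        show "CARD('n) < k - 1 + card (insert i I)"
          using Cons.prems(5) False fin by auto
        show "contract (d j) (contract (d i) \<omega>) = (\<lambda>vs. 0)" if "j \<in> insert i I" for j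
          by (rule contract_contract_eq_0[OF Cons.prems(1) i Cons.prems(3,4) that])
      qed
      then show ?thesis by (simp add: contract_def)
    qed
    have "\<omega> (v # vs) = (\<Sum>i=1..CARD('n). e i x [v] * \<omega> (d i # vs))"
      by (subst expansion[OF True], rule linear_form_on_sum[OF lin_closed lin]) (use frame in auto)
    also have "\<dots> = 0"
      using zero by (intro sum.neutral) simp
    finally show ?thesis .
  qed
qed

text \<open>Orthogonality leaves only the diagonal of the double sum, so both factors lose the same direction.\<close>

lemma contracted_wedge_Suc:
  "contracted_wedge A g e (Suc l) f h x vs =
    (\<Sum>i=1..CARD('n). dual_metric A g x (e i x) (e i x) *
      contracted_wedge A g e l (interior_product (dual_frame A e i) f)
        (interior_product (dual_frame A e i) h) x vs)"
proof -
  have diagonal: "(\<Sum>j=1..CARD('n). dual_metric A g x (e i x) (e j x) * F j) =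
      dual_metric A g x (e i x) (e i x) * F i" if "i \<in> {1..CARD('n)}" for i and F :: "nat \<Rightarrow> real"
  proof -
    have diagonal: "(\<Sum>j=1..CARD('n). dual_metric A g x (e i x) (e j x) * F j) =
        (\<Sum>j\<in>{i}. dual_metric A g x (e i x) (e j x) * F j)"
      by (rule sum.mono_neutral_right) (use that orthogonal in auto)
    then show ?thesis by simp
  qed
  show ?thesis
    unfolding contracted_wedge.simps by (intro sum.cong refl) (rule diagonal)
qed

end

lemma contracted_wedge_zero:
  assumes "f x = (\<lambda>vs. 0) \<or> h x = (\<lambda>vs. 0)"
  shows "contracted_wedge A g e l f h x vs = 0"
  using assms
proof (induction l arbitrary: f h)
  case 0
  then show ?case by (auto simp: wedge_def)
next
  case (Suc l)
  have "interior_product X f x = (\<lambda>vs. 0) \<or> interior_product Y h x = (\<lambda>vs. 0)" for X Y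
    using Suc.prems by (auto simp: interior_product_at)
  then show ?case
    using Suc.IH by (simp cong: sum.cong)
qed

context orthonormal_point
begin

text \<open>
  With \<open>I\<close> empty: the product vanishes as soon as the degrees of the factors sum up to more than
  \<open>n + l\<close>. The set \<open>I\<close> records the directions that have already been contracted away from both
  factors. A step of the induction removes one from \<open>l\<close> and from both degrees and adds one to
  \<open>|I|\<close>, so the inequality persists; at \<open>l = 0\<close> the wedge product is a form of degree \<open>k + m\<close> in only
  \<open>n - |I| < k + m\<close> directions.
\<close>

lemma contracted_wedge_eq_0:
  assumes "f x \<in> exterior_algebra A x" "homogeneous k (f x)"
    and "h x \<in> exterior_algebra A x" "homogeneous m (h x)"
    and "I \<subseteq> {1..CARD('n)}"
    and "\<And>i. i \<in> I \<Longrightarrow> contract (d i) (f x) = (\<lambda>vs. 0) \<and> contract (d i) (h x) = (\<lambda>vs. 0)"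
    and "CARD('n) + l < k + m + card I"
  shows "contracted_wedge A g e l f h x vs = 0"
  using assms
proof (induction l arbitrary: f h k m I)
  case 0
  have "wedge_at (f x) (h x) vs = 0"
  proof (rule form_eq_0)
    show "wedge_at (f x) (h x) \<in> exterior_algebra A x"
      by (rule wedge_at_exterior_algebra[OF lin_closed 0(1-4)])
    show "homogeneous (k + m) (wedge_at (f x) (h x))"
      by (rule homogeneous_wedge_at[OF 0(2,4)])
    show "contract (d i) (wedge_at (f x) (h x)) = (\<lambda>vs. 0)" if "i \<in> I" for i
      using 0(6)[OF that]
      by (simp add: contract_def[of _ "wedge_at (f x) (h x)"] wedge_at_Cons[OF 0(2)])
  qed (use 0 in auto)
  then show ?case by (simp add: wedge_def)
next
  case (Suc l)
  have fin: "finite I" using Suc.prems(5) finite_subset by blast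
  have "contracted_wedge A g e l (interior_product (dual_frame A e i) f)
      (interior_product (dual_frame A e i) h) x vs = 0" if i: "i \<in> {1..CARD('n)}" for i
  proof (cases "i \<in> I \<or> k = 0 \<or> m = 0")
    case True
    then have "contract (d i) (f x) = (\<lambda>vs. 0) \<or> contract (d i) (h x) = (\<lambda>vs. 0)"
      using Suc.prems(2,4,6) contract_homogeneous_0 by metis
    then show ?thesis
      by (intro contracted_wedge_zero) (simp add: interior_product_at)
  next
    case False
    show ?thesis
    proof (rule Suc.IH[of _ "k - 1" _ "m - 1" "insert i I"]; (unfold interior_product_at)?)
      show "CARD('n) + l < k - 1 + (m - 1) + card (insert i I)"
        using Suc.prems(7) False fin by auto
      show "insert i I \<subseteq> {1..CARD('n)}" using Suc.prems(5) i by blast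
      show "contract (d j) (contract (d i) (f x)) = (\<lambda>vs. 0) \<and>
          contract (d j) (contract (d i) (h x)) = (\<lambda>vs. 0)" if "j \<in> insert i I" for j
        using contract_contract_eq_0[OF Suc.prems(1) i Suc.prems(5) _ that]
          contract_contract_eq_0[OF Suc.prems(3) i Suc.prems(5) _ that] Suc.prems(6) by blast
    qed (use Suc.prems frame[OF i] in \<open>auto intro: exterior_algebra_contract homogeneous_contract simp del: One_nat_def\<close>)
  qed
  then show ?case
    unfolding contracted_wedge_Suc by (intro sum.neutral) simp
qed

text \<open>When all arguments are contracted, only products of scalars are left.\<close>

lemma contracted_wedge_full_commute:
  assumes "homogeneous l (f x)" "homogeneous l (h x)"
  shows "contracted_wedge A g e l f h x vs = contracted_wedge A g e l h f x vs"
  using assms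
proof (induction l arbitrary: f h)
  case 0
  have "wedge_at (f x) (h x) vs = wedge_at (h x) (f x) vs"
  proof (cases vs)
    case Nil
    then show ?thesis by (simp add: wedge_at_def)
  next
    case (Cons v ws)
    then show ?thesis
      using homogeneous_wedge_at[OF 0] homogeneous_wedge_at[OF 0(2,1)]
      by (simp add: homogeneous_def)
  qed
  then show ?case by (simp add: wedge_def)
next
  case (Suc l)
  have "homogeneous l (interior_product X f x)" "homogeneous l (interior_product X h x)" for X
    using homogeneous_contract[OF Suc.prems(1)] homogeneous_contract[OF Suc.prems(2)]
    by (simp_all add: interior_product_at)
  then show ?case
    unfolding contracted_wedge_Suc using Suc.IH by (intro sum.cong) auto
qed

text \<open>
  Of both Graf products with a top form only the term of order \<open>k\<close> survives, and for odd \<open>n\<close> the two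
  surviving terms have the same sign.
\<close>

lemma graf_homogeneous_top_central:
  assumes "odd CARD('n)" "k \<le> CARD('n)"
    and f: "f x \<in> exterior_algebra A x" "homogeneous k (f x)"
    and h: "h x \<in> exterior_algebra A x" "homogeneous CARD('n) (h x)"
  shows "graf_homogeneous A g e CARD('n) k h f x vs = graf_homogeneous A g e k CARD('n) f h x vs"
proof -
  let ?n = "CARD('n)" and ?W = "\<lambda>l f h. contracted_wedge A g e l f h x vs"
  have low: "?W l f h = 0 \<and> ?W l h f = 0" if "l < k" for l
    using contracted_wedge_eq_0[of f k h ?n "{}" l vs] contracted_wedge_eq_0[of h ?n f k "{}" l vs] f h that
    by simp
  have last: "(\<Sum>l=0..k. c l * ?W l f h) = c k * ?W k f h"
    "(\<Sum>l=0..k. c l * ?W l h f) = c k * ?W k h f" for c :: "nat \<Rightarrow> real"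
  proof -
    have "(\<Sum>l=0..k. c l * F l) = c k * F k" if "\<And>l. l < k \<Longrightarrow> F l = 0" for F :: "nat \<Rightarrow> real"
    proof -
      have "(\<Sum>l=0..k. c l * F l) = (\<Sum>l\<in>{k}. c l * F l)"
        by (rule sum.mono_neutral_right) (use that in auto)
      then show ?thesis by simp
    qed
    from this[of "\<lambda>l. ?W l f h"] this[of "\<lambda>l. ?W l h f"]
    show "(\<Sum>l=0..k. c l * ?W l f h) = c k * ?W k f h"
      "(\<Sum>l=0..k. c l * ?W l h f) = c k * ?W k h f" using low by simp_all
  qed
  show ?thesis
  proof (cases "k = ?n")
    case True
    have "?W ?n h f = ?W ?n f h"
      using contracted_wedge_full_commute f(2) h(2) True by simp
    then show ?thesis
      by (simp only: graf_homogeneous_def True order_refl if_True last[unfolded True])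
  next
    case False
    then have "\<not> ?n \<le> k" using assms(2) by simp
    have sign: "(-1::real) ^ (?n * k) * (-1) ^ k = 1"
      using assms(1) by (simp flip: power_add)
    have "graf_homogeneous A g e ?n k h f x vs =
        (-1) ^ (?n * k) * ((-1) ^ (k * (k - k + 1) + k div 2) / fact k * ?W k f h)"
      using \<open>\<not> ?n \<le> k\<close> by (simp only: graf_homogeneous_def last if_False)
    also have "\<dots> = ((-1) ^ (?n * k) * (-1) ^ k) * ((-1) ^ (k div 2) / fact k * ?W k f h)"
      by (simp add: power_add)
    also have "\<dots> = graf_homogeneous A g e k ?n f h x vs"
      using assms(2) by (simp only: graf_homogeneous_def last sign if_True) simp
    finally show ?thesis .
  qed
qed

end

section \<open>Centrality of the volume element\<close>

lemma volume_element_at: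
  fixes A :: "('a, 'n::finite) chart set"
  assumes T: "lin_closed (tangent_space A x)" and x: "x \<in> U"
    and e: "\<And>i. i \<in> {1..CARD('n)} \<Longrightarrow> e i x \<in> cotangent_space A x"
  shows "volume_element U e x \<in> exterior_algebra A x"
    and "homogeneous CARD('n) (volume_element U e x)"
proof -
  have "foldr (\<lambda>i f. wedge (e i) f) js (one_form_field U) x \<in> exterior_algebra A x \<and>
      homogeneous (length js) (foldr (\<lambda>i f. wedge (e i) f) js (one_form_field U) x)"
    if "set js \<subseteq> {1..CARD('n)}" for js
    using that
  proof (induction js)
    case Nil
    show ?case
      using x by (auto simp: one_form_field_def exterior_algebra_def homogeneous_def)
  next
    case (Cons j js)
    have "e j x \<in> exterior_algebra A x" "homogeneous 1 (e j x)"
      using e[of j] Cons.prems by (auto simp: cotangent_space_def)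
    moreover have "foldr (\<lambda>i f. wedge (e i) f) js (one_form_field U) x \<in> exterior_algebra A x"
      "homogeneous (length js) (foldr (\<lambda>i f. wedge (e i) f) js (one_form_field U) x)"
      using Cons by auto
    ultimately show ?case
      using wedge_at_exterior_algebra[OF T] homogeneous_wedge_at[of 1 "e j x" "length js"]
      by (auto simp: wedge_def)
  qed
  moreover have "set [1..<Suc CARD('n)] \<subseteq> {1..CARD('n)}" "length [1..<Suc CARD('n)] = CARD('n)"
    by auto
  ultimately show "volume_element U e x \<in> exterior_algebra A x" "homogeneous CARD('n) (volume_element U e x)"
    unfolding volume_element_def by metis+
qed

lemma degree_part_exterior_algebra:
  assumes "f x \<in> exterior_algebra A x"
  shows "degree_part k f x \<in> exterior_algebra A x"
  unfolding exterior_algebra_def mem_Collect_eq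
proof (intro conjI allI impI)
  fix vs assume "\<not> set vs \<subseteq> tangent_space A x"
  then show "degree_part k f x vs = 0"
    using exterior_algebra_outside[OF assms] by (simp add: degree_part_def)
next
  fix vs i u w a b
  assume "set vs \<subseteq> tangent_space A x \<and> i < length vs \<and> u \<in> tangent_space A x \<and> w \<in> tangent_space A x"
  then have "f x (vs[i := lin_comb a u b w]) = a * f x (vs[i := u]) + b * f x (vs[i := w])"
    using assms by (simp add: exterior_algebra_multilinear)
  then show "degree_part k f x (vs[i := lin_comb a u b w])
      = a * degree_part k f x (vs[i := u]) + b * degree_part k f x (vs[i := w])"
    by (simp add: degree_part_def)
next
  fix vs i j
  assume "set vs \<subseteq> tangent_space A x \<and> i < j \<and> j < length vs \<and> vs ! i = vs ! j"
  then have "f x vs = 0"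
    using exterior_algebra_repeated[OF assms] by blast
  then show "degree_part k f x vs = 0"
    by (simp add: degree_part_def)
qed

lemma homogeneous_degree_part: "homogeneous k (degree_part k f x)"
  by (simp add: homogeneous_def degree_part_def)

lemma graf_homogeneous_zero:
  assumes "f x = (\<lambda>vs. 0) \<or> h x = (\<lambda>vs. 0)"
  shows "graf_homogeneous A g e r s f h x vs = 0"
proof -
  have "contracted_wedge A g e l f h x vs = 0" "contracted_wedge A g e l h f x vs = 0" for l
    using contracted_wedge_zero[of f x h] contracted_wedge_zero[of h x f] assms by blast+
  then show ?thesis by (simp add: graf_homogeneous_def)
qed

theorem proposition3p10:
  fixes M :: "'a topology" and A :: "('a, 'n::finite) chart set"
    and g :: "'a \<Rightarrow> ('a, 'n) tvec \<Rightarrow> ('a, 'n) tvec \<Rightarrow> real" and p q :: nat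
    and U :: "'a set" and e :: "nat \<Rightarrow> ('a, 'n) form_field"
  assumes "pseudo_riemannian_manifold M A g p q"
    and "paracompact_space M" and "connected_space M"
    and "openin M U" and "orthonormal_coframe A g p U e"
    and "odd CARD('n)"
  shows "\<forall>f \<in> form_sections A U.
    graf A g e (volume_element U e) f = graf A g e f (volume_element U e)"
proof (intro ballI ext)
  fix f x vs
  assume f: "f \<in> form_sections A U"
  interpret pseudo_riemannian_manifold M A g p q by fact
  let ?n = "CARD('n)" and ?v = "volume_element U e"
  \<comment> \<open>Off \<open>U\<close>, where there is no frame, both sides vanish because the section \<open>f\<close> does.\<close>
  have "graf_homogeneous A g e r s (degree_part r ?v) (degree_part s f) x vs =
      graf_homogeneous A g e s r (degree_part s f) (degree_part r ?v) x vs" if s: "s \<le> ?n" for r s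
  proof (cases "x \<in> U")
    case False
    then have "degree_part s f x = (\<lambda>vs. 0)"
      using f by (auto simp: form_sections_def degree_part_def)
    then show ?thesis by (simp add: graf_homogeneous_zero)
  next
    case True
    then have "x \<in> topspace M"
      using \<open>openin M U\<close> openin_subset by blast
    then obtain b where b: "basis_of ?n b (tangent_space A x)"
      using metric_signature by blast
    have e: "basis_of ?n (\<lambda>i. e i x) (cotangent_space A x)"
      using assms(5) True by (auto simp: orthonormal_coframe_def coframe_def)
    interpret orthonormal_point A g e x
    proof
      show "lin_closed (tangent_space A x)" by (rule tangent_space_lin_closed)
      show "dual_frame A e i x \<in> tangent_space A x" if "i \<in> {1..?n}" for i
        using dual_frame_expansion(1)[where e = e and x = x, OF tangent_space_lin_closed b e that] .
      show "v = (\<lambda>z. \<Sum>i=1..?n. e i x [v] *\<^sub>R dual_frame A e i x z)"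
        if "v \<in> tangent_space A x" for v
        using dual_frame_expansion(2)[where e = e and x = x, OF tangent_space_lin_closed b e that] .
      show "dual_metric A g x (e i x) (e j x) = 0"
        if "i \<in> {1..?n}" "j \<in> {1..?n}" "i \<noteq> j" for i j
        using assms(5) True that by (simp add: orthonormal_coframe_def)
    qed
    have v: "?v x \<in> exterior_algebra A x" "homogeneous ?n (?v x)"
      by (rule volume_element_at[OF lin_closed True]; use e in \<open>simp add: basis_of_def\<close>)+
    show ?thesis
    proof (cases "r = ?n")
      case False
      then have "degree_part r ?v x = (\<lambda>vs. 0)"
        using v(2) by (auto simp: degree_part_def homogeneous_def)
      then show ?thesis by (simp add: graf_homogeneous_zero)
    next
      case True
      have "f x \<in> exterior_algebra A x"
        using f \<open>x \<in> U\<close> by (simp add: form_sections_def)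
      then have "degree_part s f x \<in> exterior_algebra A x" "degree_part ?n ?v x \<in> exterior_algebra A x"
        using v(1) by (auto intro: degree_part_exterior_algebra)
      then show ?thesis
        unfolding True using graf_homogeneous_top_central[of s "degree_part s f" "degree_part ?n ?v"]
        by (simp add: assms(6) s homogeneous_degree_part)
    qed
  qed
  then have "graf A g e ?v f x vs = (\<Sum>r=0..?n. \<Sum>s=0..?n.
      graf_homogeneous A g e s r (degree_part s f) (degree_part r ?v) x vs)"
    unfolding graf_def by (intro sum.cong) auto
  also have "\<dots> = graf A g e f ?v x vs"
    unfolding graf_def by (rule sum.swap)
  finally show "graf A g e ?v f x vs = graf A g e f ?v x vs" .
qed

end
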